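(* Let $A,C,\sigma,R_a$ be positive real numbers and consider the system $$\dot x=Ayz+Cz-\sigma x,\qquad \dot y=-xz+R_a-y,\qquad \dot z=-z+xy$$ on $\mathbb{R}^3$, with equilibrium $E_0=(0,R_a,0)$. Assume $R_a=R_a^*$, where $$R_a^*=\frac{\sqrt{C^2+4A\sigma}-C}{2A}.$$ Then the system undergoes a cusp bifurcation at $E_0$.
   Context: A cusp bifurcation (of co-dimension two) at an equilibrium corresponds to the equilibrium having a simple zero eigenvalue and the quadratic coefficient vanishing; here the quadratic coefficient is the coefficient $b$ in the restriction $\dot w=bw^2+cw^3+O(w^4)$ of the system to the one-dimensional center manifold at the equilibrium. *)

theory Defs
  imports
    "HOL-Analysis.Analysis"
    "HOL-Computational_Algebra.Polynomial"
    "HOL-Library.Landau_Symbols"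
begin

text \<open>The determinant of \<open>X I - J\<close>, taken over \<open>complex poly\<close> so that all eigenvalues of the
  real matrix \<open>J\<close> are visible as roots and multiplicities are algebraic ones.\<close>

definition char_polynomial :: "real^'n^'n \<Rightarrow> complex poly" where
  "char_polynomial J =
     det (\<chi> i j. (if i = j then [:0, 1:] else 0) - [:complex_of_real (J $ i $ j):])"

definition simple_eigenvalue :: "real^'n^'n \<Rightarrow> complex \<Rightarrow> bool" where
  "simple_eigenvalue J l \<longleftrightarrow> order l (char_polynomial J) = 1"

primrec Ck_on :: "nat \<Rightarrow> (real \<Rightarrow> 'a::real_normed_vector) \<Rightarrow> real set \<Rightarrow> bool" where
  "Ck_on 0 f S \<longleftrightarrow> continuous_on S f"
| "Ck_on (Suc k) f S \<longleftrightarrow>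
     (\<exists>f'. (\<forall>t\<in>S. (f has_vector_derivative f' t) (at t)) \<and> Ck_on k f' S)"

text \<open>\<open>\<phi>\<close> is a local coordinate \<open>w \<mapsto> \<phi> w\<close> on a one-dimensional center manifold of \<open>x' = F x\<close> at
  the equilibrium \<open>E\<close>, and \<open>w' = g w\<close> is the restriction of the system to it. The curve passes
  through \<open>E\<close> tangentially to the kernel of the Jacobian, which is the center eigenspace
  whenever 0 is a simple eigenvalue and the only one on the imaginary axis. Local invariance is
  tangency of \<open>F\<close> to the curve: \<open>F (\<phi> w) = g w \<phi>' w\<close> says exactly that \<open>\<phi>\<close> carries solutions of
  \<open>w' = g w\<close> to solutions of \<open>x' = F x\<close>. Class \<open>C^3\<close> suffices for \<open>g\<close> to have an expansion with
  error \<open>O(w^4)\<close> when \<open>F\<close> is smooth.\<close>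

definition center_manifold_restriction ::
    "(real^'n \<Rightarrow> real^'n) \<Rightarrow> real^'n \<Rightarrow> (real \<Rightarrow> real^'n) \<Rightarrow> (real \<Rightarrow> real) \<Rightarrow> bool" where
  "center_manifold_restriction F E \<phi> g \<longleftrightarrow>
     (\<exists>\<delta>>0. Ck_on 3 \<phi> {-\<delta><..<\<delta>} \<and>
        \<phi> 0 = E \<and>
        vector_derivative \<phi> (at 0) \<noteq> 0 \<and>
        jacobian F (at E) *v vector_derivative \<phi> (at 0) = 0 \<and>
        (\<forall>w\<in>{-\<delta><..<\<delta>}. F (\<phi> w) = g w *\<^sub>R vector_derivative \<phi> (at w)))"

definition cubic_expansion :: "(real \<Rightarrow> real) \<Rightarrow> real \<Rightarrow> real \<Rightarrow> bool" where
  "cubic_expansion g b c \<longleftrightarrow> (\<lambda>w. g w - (b * w^2 + c * w^3)) \<in> O[at 0](\<lambda>w. w^4)"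

text \<open>Since a center manifold is in general not unique (and neither is its coordinate), the
  condition on the quadratic coefficient \<open>b\<close> is imposed on every center manifold of class
  \<open>C^3\<close>; existence is the classical center manifold theorem. The third clause says that the
  center manifold is one-dimensional.\<close>

definition cusp_bifurcation :: "(real^'n \<Rightarrow> real^'n) \<Rightarrow> real^'n \<Rightarrow> bool" where
  "cusp_bifurcation F E \<longleftrightarrow>
     F E = 0 \<and> F differentiable (at E) \<and>
     simple_eigenvalue (jacobian F (at E)) 0 \<and>
     (\<forall>l. poly (char_polynomial (jacobian F (at E))) l = 0 \<and> Re l = 0 \<longrightarrow> l = 0) \<and>
     (\<forall>\<phi> g. center_manifold_restriction F E \<phi> g \<longrightarrow>
        (\<exists>b c. cubic_expansion g b c \<and> b = 0))"

definition system_field :: "real \<Rightarrow> real \<Rightarrow> real \<Rightarrow> real \<Rightarrow> real^3 \<Rightarrow> real^3" where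
  "system_field A C \<sigma> Ra X =
     (let x = X $ 1; y = X $ 2; z = X $ 3
      in vector [A * y * z + C * z - \<sigma> * x, - x * z + Ra - y, - z + x * y])"

end

theory Submission
  imports Defs
begin

text \<open>At \<open>R\<^sub>a\<^sup>*\<close> the Jacobian at \<open>E\<^sub>0\<close> has eigenvalues \<open>0, -1, -(1 + \<sigma>)\<close> and \<open>(1, 0, K)\<close> with
  \<open>K = A R\<^sub>a + C\<close> spans its left kernel. Along the flow, \<open>x + K z\<close> has derivative
  \<open>(y - R\<^sub>a) (A z + K x)\<close>. On a center manifold \<open>x, z\<close> are of order \<open>w\<close> and \<open>y - R\<^sub>a\<close> is of order
  \<open>w\<^sup>2\<close>, so the reduced field is of order \<open>w\<^sup>3\<close>; the equation for \<open>y\<close> then gives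
  \<open>y - R\<^sub>a = - x z + O(w\<^sup>4)\<close>, which yields the cubic coefficient with an error \<open>O(w\<^sup>4)\<close>.\<close>

text \<open>Derivatives are unique, so the existential witness in \<open>Ck_on\<close> agrees with
  \<open>vector_derivative\<close> on \<open>S\<close>. Agreement on \<open>S\<close> alone is
  enough to transfer the remaining regularity, since \<open>S\<close> is open.\<close>

lemma Ck_on_imp_has_vector_derivative:
  assumes "Ck_on (Suc k) f S" and "open S"
  shows "\<And>t. t \<in> S \<Longrightarrow> (f has_vector_derivative vector_derivative f (at t)) (at t)"
    and "Ck_on k (\<lambda>t. vector_derivative f (at t)) S"
proof -
  have Ck_cong: "Ck_on k f' S"
    if "Ck_on k g S" "\<And>t. t \<in> S \<Longrightarrow> f' t = g t" for f' g :: "real \<Rightarrow> 'a"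
    using that
  proof (cases k)
    case 0
    with that show ?thesis by (simp cong: continuous_on_cong)
  next
    case (Suc n)
    with that(1) obtain h where h: "\<And>t. t \<in> S \<Longrightarrow> (g has_vector_derivative h t) (at t)"
      and "Ck_on n h S" by auto
    moreover have "(f' has_vector_derivative h t) (at t)" if "t \<in> S" for t
      using has_vector_derivative_transform_within_open[OF h[OF that] \<open>open S\<close> that]
        \<open>\<And>t. t \<in> S \<Longrightarrow> f' t = g t\<close> by simp
    ultimately show ?thesis using Suc by auto
  qed
  obtain f' where f': "\<And>t. t \<in> S \<Longrightarrow> (f has_vector_derivative f' t) (at t)" "Ck_on k f' S"
    using assms by auto
  have eq: "vector_derivative f (at t) = f' t" if "t \<in> S" for t
    using f'(1)[OF that] by (rule vector_derivative_at)
  show "(f has_vector_derivative vector_derivative f (at t)) (at t)" if "t \<in> S" for t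
    using f'(1)[OF that] eq[OF that] by simp
  show "Ck_on k (\<lambda>t. vector_derivative f (at t)) S"
    using f'(2) eq by (rule Ck_cong)
qed

lemma real_differentiable_at_0_bigo:
  fixes f :: "real \<Rightarrow> real"
  assumes "(f has_real_derivative D) (at 0)"
  shows "(\<lambda>w. f w - f 0) \<in> O[at 0](\<lambda>w. w)"
proof -
  have "((\<lambda>w. (f w - f 0) / w) \<longlongrightarrow> D) (at 0)"
    using assms by (simp add: has_field_derivative_iff)
  then show ?thesis
    by (rule bigoI_tendsto) (simp add: eventually_at_filter)
qed

text \<open>Mean value inequality for \<open>f t - f' 0 * t\<close>: its derivative
  \<open>f' t - f' 0\<close> is bounded near 0 by a multiple of the absolute value of
  \<open>t\<close>, because \<open>f'\<close> is differentiable at 0.\<close>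

lemma taylor_linear_bigo:
  fixes f f' :: "real \<Rightarrow> real"
  assumes deriv: "eventually (\<lambda>w. (f has_real_derivative f' w) (at w)) (nhds 0)"
    and deriv2: "(f' has_real_derivative D) (at 0)"
  shows "(\<lambda>w. f w - (f 0 + f' 0 * w)) \<in> O[at 0](\<lambda>w. w^2)"
proof -
  obtain M where "M > 0" and bound: "eventually (\<lambda>w. norm (f' w - f' 0) \<le> M * norm w) (at 0)"
    using real_differentiable_at_0_bigo[OF deriv2] by (auto elim: landau_o.bigE)
  \<comment> \<open>The bound is trivial at \<open>w = 0\<close>, so it extends from the punctured
    to a full neighbourhood.\<close>
  have M: "eventually (\<lambda>w. \<bar>f' w - f' 0\<bar> \<le> M * \<bar>w\<bar>) (nhds 0)"
    using bound[unfolded eventually_at_filter] by (rule eventually_mono) auto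
  from eventually_conj[OF deriv M] obtain e where "e > 0"
    and e: "\<And>w. dist w 0 < e \<Longrightarrow>
      (f has_real_derivative f' w) (at w) \<and> \<bar>f' w - f' 0\<bar> \<le> M * \<bar>w\<bar>"
    unfolding eventually_nhds_metric by blast
  have "\<bar>f w - (f 0 + f' 0 * w)\<bar> \<le> M * w^2" if "\<bar>w\<bar> < e" for w
  proof -
    let ?h = "\<lambda>t. f t - f' 0 * t"
    have "norm (?h w - ?h 0) \<le> (M * \<bar>w\<bar>) * norm (w - 0)"
    \<comment> \<open>The symmetric interval contains both 0 and \<open>w\<close>, whatever the sign
      of \<open>w\<close>.\<close>
    proof (rule field_differentiable_bound[where S = "{- \<bar>w\<bar>..\<bar>w\<bar>}" and f' = "\<lambda>t. f' t - f' 0"])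
      fix t assume t: "t \<in> {- \<bar>w\<bar>..\<bar>w\<bar>}"
      then have et: "(f has_real_derivative f' t) (at t)" "\<bar>f' t - f' 0\<bar> \<le> M * \<bar>t\<bar>"
        using e[of t] that by auto
      show "(?h has_real_derivative f' t - f' 0) (at t within {- \<bar>w\<bar>..\<bar>w\<bar>})"
        by (rule DERIV_subset[of _ _ _ UNIV]) (auto intro!: derivative_eq_intros et)
      have "M * \<bar>t\<bar> \<le> M * \<bar>w\<bar>"
        using t \<open>M > 0\<close> by (intro mult_left_mono) auto
      then show "norm (f' t - f' 0) \<le> M * \<bar>w\<bar>" using et by simp
    qed auto
    then show ?thesis by (simp add: power2_eq_square abs_mult algebra_simps)
  qed
  then have "eventually (\<lambda>w. norm (f w - (f 0 + f' 0 * w)) \<le> M * norm (w^2)) (at 0)"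
    unfolding eventually_at using \<open>e > 0\<close> by (intro exI[of _ e]) (auto simp: dist_real_def)
  then show ?thesis by (rule bigoI)
qed

lemma bigo_power_at_0_mono:
  fixes f :: "real \<Rightarrow> real"
  assumes "f \<in> O[at 0](\<lambda>w. w^n)" and "m \<le> n"
  shows "f \<in> O[at 0](\<lambda>w. w^m)"
proof -
  have "eventually (\<lambda>w::real. norm (w^n) \<le> 1 * norm (w^m)) (at 0)"
    unfolding eventually_at
    using assms(2) by (intro exI[of _ 1]) (auto simp: power_abs dist_real_def intro: power_decreasing)
  then have "(\<lambda>w::real. w^n) \<in> O[at 0](\<lambda>w. w^m)" by (rule bigoI)
  with assms(1) show ?thesis by (rule landau_o.big_trans)
qed

lemma bigo_mult_power:
  fixes f g :: "real \<Rightarrow> real"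
  assumes "f \<in> O[F](\<lambda>w. w^m)" and "g \<in> O[F](\<lambda>w. w^n)"
  shows "(\<lambda>w. f w * g w) \<in> O[F](\<lambda>w. w^(m+n))"
  using landau_o.big_mult[OF assms] by (simp add: power_add)

text \<open>Here \<open>y\<close> is the deviation of the second coordinate from \<open>R\<^sub>a\<close>, while \<open>l'\<close> and \<open>y'\<close> are the
  velocities of \<open>x + K z\<close> and \<open>y\<close> along the manifold.\<close>

lemma reduced_cubic_expansion:
  fixes x y z g l' y' :: "real \<Rightarrow> real" and a d l A K :: real
  assumes x: "(\<lambda>w. x w - a * w) \<in> O[at 0](\<lambda>w. w^2)"
    and z: "(\<lambda>w. z w - d * w) \<in> O[at 0](\<lambda>w. w^2)"
    and y: "y \<in> O[at 0](\<lambda>w. w^2)"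
    and y': "y' \<in> O[at 0](\<lambda>w. w)"
    and l': "(\<lambda>w. l' w - l) \<in> O[at 0](\<lambda>w. w)" and "l \<noteq> 0"
    and gl: "eventually (\<lambda>w. g w * l' w = y w * (A * z w + K * x w)) (at 0)"
    and gy: "eventually (\<lambda>w. g w * y' w = - x w * z w - y w) (at 0)"
  shows "cubic_expansion g 0 (- (a * d) * (A * d + K * a) / l)"
proof -
  have lin: "(\<lambda>w::real. k * w) \<in> O[at 0](\<lambda>w. w^1)" for k :: real
    by simp
  have x1: "x \<in> O[at 0](\<lambda>w. w^1)"
    using sum_in_bigo(1)[OF bigo_power_at_0_mono[OF x, of 1] lin[of a]] by simp
  have z1: "z \<in> O[at 0](\<lambda>w. w^1)"
    using sum_in_bigo(1)[OF bigo_power_at_0_mono[OF z, of 1] lin[of d]] by simp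
  define p where "p w = A * z w + K * x w" for w
  have p2: "(\<lambda>w. p w - (A * d + K * a) * w) \<in> O[at 0](\<lambda>w. w^2)"
  proof -
    have "(\<lambda>w. A * (z w - d * w) + K * (x w - a * w)) \<in> O[at 0](\<lambda>w. w^2)"
      using x z by (intro sum_in_bigo) auto
    then show ?thesis by (simp add: p_def algebra_simps)
  qed
  have p1: "p \<in> O[at 0](\<lambda>w. w^1)"
    using sum_in_bigo(1)[OF bigo_power_at_0_mono[OF p2, of 1] lin[of "A * d + K * a"]] by simp
  have yp: "(\<lambda>w. y w * p w) \<in> O[at 0](\<lambda>w. w^3)"
    using bigo_mult_power[OF y p1] by simp
  have l'_lim: "(l' \<longlongrightarrow> l) (at 0)"
  proof -
    have "(\<lambda>w::real. w) \<in> o[at 0](\<lambda>_. 1::real)"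
      by (rule smalloI_tendsto) (auto intro!: tendsto_eq_intros)
    with l' have "(\<lambda>w. l' w - l) \<in> o[at 0](\<lambda>_. 1)"
      by (rule landau_o.big_small_trans)
    then have "((\<lambda>w. l' w - l) \<longlongrightarrow> 0) (at 0)" by (auto dest: smalloD_tendsto)
    then show ?thesis by (simp add: LIM_zero_iff)
  qed
  have "((\<lambda>w. inverse (l' w)) \<longlongrightarrow> inverse l) (at 0)"
    using l'_lim \<open>l \<noteq> 0\<close> by (rule tendsto_inverse)
  then have inv_l': "(\<lambda>w. inverse (l' w)) \<in> O[at 0](\<lambda>w. w^0)"
    by (intro bigoI_tendsto[where c = "inverse l"]) auto
  have "eventually (\<lambda>w. l' w \<noteq> 0) (at 0)"
    using tendsto_imp_eventually_ne[OF l'_lim \<open>l \<noteq> 0\<close>] .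
  with gl have "eventually (\<lambda>w. g w = y w * p w * inverse (l' w)) (at 0)"
    by eventually_elim (simp add: p_def field_simps)
  \<comment> \<open>This is where the quadratic coefficient is forced to vanish: \<open>g\<close> is
    \<open>y * p / l'\<close>, with \<open>y\<close> of order 2, \<open>p\<close> of order 1 and
    \<open>1 / l'\<close> bounded since \<open>l\<close> is nonzero.\<close>
  then have g3: "g \<in> O[at 0](\<lambda>w. w^3)"
    using bigo_mult_power[OF yp inv_l'] by (simp add: landau_o.big.in_cong)
  have gy': "(\<lambda>w. g w * y' w) \<in> O[at 0](\<lambda>w. w^3)"
    using bigo_power_at_0_mono[OF bigo_mult_power[OF g3, of y' 1], of 3] y' by simp
  \<comment> \<open>This expression is \<open>x * z - a * d * w^2\<close>, split so that each
    product contains one Taylor remainder. Solving \<open>gy\<close> for \<open>y\<close> then gives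
    \<open>y = - a * d * w^2\<close> up to order 3.\<close>
  have "(\<lambda>w. (x w - a * w) * z w + a * w * (z w - d * w)) \<in> O[at 0](\<lambda>w. w^3)"
    using bigo_mult_power[OF x z1] bigo_mult_power[OF lin[of a] z]
    by (intro sum_in_bigo) (simp_all add: numeral_3_eq_3 numeral_2_eq_2)
  then have "(\<lambda>w. - ((x w - a * w) * z w + a * w * (z w - d * w)) - g w * y' w)
      \<in> O[at 0](\<lambda>w. w^3)"
    using gy' by (intro sum_in_bigo(2)) (simp_all only: landau_o.big.uminus_in_iff)
  moreover have "eventually (\<lambda>w. - ((x w - a * w) * z w + a * w * (z w - d * w)) - g w * y' w
      = y w + a * d * w^2) (at 0)"
    using gy by eventually_elim (simp add: algebra_simps power2_eq_square)
  ultimately have y3: "(\<lambda>w. y w + a * d * w^2) \<in> O[at 0](\<lambda>w. w^3)"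
    by (simp add: landau_o.big.in_cong)
  have quad: "(\<lambda>w::real. a * d * w^2) \<in> O[at 0](\<lambda>w. w^2)" by simp
  have gl': "(\<lambda>w. g w * (l' w - l)) \<in> O[at 0](\<lambda>w. w^4)"
    using bigo_mult_power[OF g3, of "\<lambda>w. l' w - l" 1] l' by simp
  \<comment> \<open>Each of the three terms pairs a remainder with a factor of known order. By
    \<open>gl\<close> the products \<open>y * p\<close> and \<open>g * l'\<close> cancel, and what
    is left is \<open>l * g + a * d * (A * d + K * a) * w^3\<close>.\<close>
  have "(\<lambda>w. (y w + a * d * w^2) * p w - a * d * w^2 * (p w - (A * d + K * a) * w)
      - g w * (l' w - l)) \<in> O[at 0](\<lambda>w. w^4)"
    using bigo_mult_power[OF y3 p1] bigo_mult_power[OF quad p2] gl'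
    by (intro sum_in_bigo) simp_all
  then have "(\<lambda>w. 1 / l * ((y w + a * d * w^2) * p w
      - a * d * w^2 * (p w - (A * d + K * a) * w) - g w * (l' w - l))) \<in> O[at 0](\<lambda>w. w^4)"
    using \<open>l \<noteq> 0\<close> by simp
  moreover have "eventually (\<lambda>w. 1 / l * ((y w + a * d * w^2) * p w
      - a * d * w^2 * (p w - (A * d + K * a) * w) - g w * (l' w - l))
      = g w - (0 * w^2 + - (a * d) * (A * d + K * a) / l * w^3)) (at 0)"
    using gl
  proof eventually_elim
    case (elim w)
    have "(y w + a * d * w^2) * p w - a * d * w^2 * (p w - (A * d + K * a) * w)
        - g w * (l' w - l) = l * g w + a * d * (A * d + K * a) * w^3"
      using elim by (simp add: p_def[symmetric]) (simp add: algebra_simps power2_eq_square power3_eq_cube)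
    then show ?case using \<open>l \<noteq> 0\<close> by (simp add: field_simps)
  qed
  ultimately show ?thesis
    unfolding cubic_expansion_def by (simp add: landau_o.big.in_cong)
qed

text \<open>The base point is the equilibrium (0, \<open>Ra\<close>, 0), where every partial
  derivative carrying a factor x or z vanishes.\<close>

definition system_jacobian :: "real \<Rightarrow> real \<Rightarrow> real \<Rightarrow> real \<Rightarrow> real^3^3" where
  "system_jacobian A C \<sigma> Ra =
     vector [vector [- \<sigma>, 0, A * Ra + C], vector [0, -1, 0], vector [Ra, 0, -1]]"

lemma system_jacobian_mult:
  "system_jacobian A C \<sigma> Ra *v h =
     vector [(A * Ra + C) * h $ 3 - \<sigma> * h $ 1, - h $ 2, Ra * h $ 1 - h $ 3]"
  by (simp add: system_jacobian_def vec_eq_iff forall_3 matrix_vector_mult_def sum_3)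

lemma has_derivative_vector_3:
  fixes f g h :: "'a::real_normed_vector \<Rightarrow> real"
  assumes "(f has_derivative f') F" and "(g has_derivative g') F" and "(h has_derivative h') F"
  shows "((\<lambda>x. vector [f x, g x, h x] :: real^3) has_derivative
    (\<lambda>x. vector [f' x, g' x, h' x])) F"
proof -
  have eq: "vector [p, q, r] = p *\<^sub>R axis 1 1 + q *\<^sub>R axis 2 1 + (r::real) *\<^sub>R (axis 3 1 :: real^3)"
    for p q r
    by (simp add: vec_eq_iff forall_3 axis_def)
  show ?thesis unfolding eq using assms by (auto intro!: derivative_eq_intros)
qed

lemma system_field_has_derivative:
  "(system_field A C \<sigma> Ra has_derivative (\<lambda>h. system_jacobian A C \<sigma> Ra *v h))
     (at (vector [0, Ra, 0]))"
proof -
  have nth: "((\<lambda>X::real^3. X $ i) has_derivative (\<lambda>h. h $ i)) F" for i F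
    by (rule bounded_linear.has_derivative[OF bounded_linear_vec_nth has_derivative_ident])
  show ?thesis
    unfolding system_jacobian_mult system_field_def[abs_def] Let_def
    by (rule has_derivative_vector_3) (auto intro!: derivative_eq_intros nth simp: algebra_simps)
qed

lemma jacobian_system_field:
  "jacobian (system_field A C \<sigma> Ra) (at (vector [0, Ra, 0])) = system_jacobian A C \<sigma> Ra"
  unfolding jacobian_def frechet_derivative_at[OF system_field_has_derivative, symmetric]
  by (rule matrix_of_matrix_vector_mul)

text \<open>The second coordinate decouples with eigenvalue -1. The block of the other two has trace
  \<open>-(1 + \<sigma>)\<close> and determinant \<open>\<sigma> - Ra * (A * Ra + C)\<close>, which
  is zero under the hypothesis.\<close>

lemma char_polynomial_system_jacobian:
  assumes "Ra * (A * Ra + C) = \<sigma>"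
  shows "char_polynomial (system_jacobian A C \<sigma> Ra) =
    [:0, 1:] * ([:1, 1:] * [:complex_of_real (1 + \<sigma>), 1:])"
  unfolding char_polynomial_def det_3 system_jacobian_def assms[symmetric]
  by (simp add: algebra_simps)

theorem theorem4p6:
  fixes A C \<sigma> Ra :: real
  assumes "A > 0" and "C > 0" and "\<sigma> > 0" and "Ra > 0"
    and "Ra = (sqrt (C^2 + 4 * A * \<sigma>) - C) / (2 * A)"
  shows "cusp_bifurcation (system_field A C \<sigma> Ra) (vector [0, Ra, 0])"
proof -
  let ?F = "system_field A C \<sigma> Ra" and ?E = "vector [0, Ra, 0] :: real^3"
  let ?J = "system_jacobian A C \<sigma> Ra"
  define K where "K = A * Ra + C"
  \<comment> \<open>Isolating the square root and squaring turns the formula for \<open>Ra\<close>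
    into the quadratic equation \<open>Ra * (A * Ra + C) = \<sigma>\<close>, the condition for a
    zero eigenvalue.\<close>
  have "sqrt (C^2 + 4 * A * \<sigma>) = 2 * A * Ra + C"
    using assms by (simp add: field_simps)
  moreover have "C^2 + 4 * A * \<sigma> \<ge> 0" using assms by simp
  ultimately have "C^2 + 4 * A * \<sigma> = (2 * A * Ra + C)^2"
    by (metis real_sqrt_pow2)
  then have "4 * A * (Ra * (A * Ra + C)) = 4 * A * \<sigma>"
    by (simp add: power2_eq_square algebra_simps)
  then have crit: "Ra * (A * Ra + C) = \<sigma>" using \<open>A > 0\<close> by simp
  note char = char_polynomial_system_jacobian[OF crit]
  have "order 0 (char_polynomial ?J) = 1"
  proof -
    have "order 0 [:0, 1::complex:] = 1"
      using order_power_n_n[of "0::complex" 1] by simp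
    moreover have "order 0 ([:1, 1:] * [:complex_of_real (1 + \<sigma>), 1:]) = 0"
      using \<open>\<sigma> > 0\<close> by (intro order_0I) (simp add: complex_eq_iff)
    ultimately show ?thesis unfolding char by (subst order_mult) auto
  qed
  moreover have "l = 0" if "poly (char_polynomial ?J) l = 0" and "Re l = 0" for l
    using that \<open>\<sigma> > 0\<close> unfolding char by (auto simp: complex_eq_iff)
  moreover have "\<exists>b c. cubic_expansion g b c \<and> b = 0"
    if cm: "center_manifold_restriction ?F ?E \<phi> g" for \<phi> g
  proof -
    obtain \<delta> where "\<delta> > 0" and Ck: "Ck_on 3 \<phi> {-\<delta><..<\<delta>}" and \<phi>0: "\<phi> 0 = ?E"
      and nz: "vector_derivative \<phi> (at 0) \<noteq> 0"
      and ker: "?J *v vector_derivative \<phi> (at 0) = 0"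
      and inv: "\<And>w. w \<in> {-\<delta><..<\<delta>} \<Longrightarrow> ?F (\<phi> w) = g w *\<^sub>R vector_derivative \<phi> (at w)"
      using cm unfolding center_manifold_restriction_def jacobian_system_field by blast
    define \<phi>' where "\<phi>' w = vector_derivative \<phi> (at w)" for w
    define \<phi>'' where "\<phi>'' w = vector_derivative \<phi>' (at w)" for w
    have nhd: "eventually (\<lambda>w. w \<in> {-\<delta><..<\<delta>}) (nhds 0)"
      using \<open>\<delta> > 0\<close> by (intro eventually_nhds_in_open) auto
    have d1: "(\<phi> has_vector_derivative \<phi>' w) (at w)" and Ck': "Ck_on 2 \<phi>' {-\<delta><..<\<delta>}"
      if "w \<in> {-\<delta><..<\<delta>}" for w
      using Ck_on_imp_has_vector_derivative[of 2 \<phi> "{-\<delta><..<\<delta>}"] Ck that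
      unfolding \<phi>'_def by (auto simp: numeral_3_eq_3 numeral_2_eq_2)
    \<comment> \<open>The second derivative at 0 yields the expansion of \<phi> with error O(w^2)
      and of its velocity with error O(w).\<close>
    have d2: "(\<phi>' has_vector_derivative \<phi>'' 0) (at 0)"
      using Ck_on_imp_has_vector_derivative(1)[of 1 \<phi>' "{-\<delta><..<\<delta>}" 0] Ck'[of 0] \<open>\<delta> > 0\<close>
      unfolding \<phi>''_def by (simp add: numeral_2_eq_2)
    have comp: "((\<lambda>w. f w $ i) has_real_derivative D $ i) (at w)"
      if "(f has_vector_derivative D) (at w)" for f :: "real \<Rightarrow> real^3" and D w i
      using bounded_linear.has_vector_derivative[OF bounded_linear_vec_nth that]
      by (simp add: has_real_derivative_iff_has_vector_derivative)
    have taylor: "(\<lambda>w. \<phi> w $ i - (\<phi> 0 $ i + \<phi>' 0 $ i * w)) \<in> O[at 0](\<lambda>w. w^2)" for i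
      using eventually_mono[OF nhd comp[OF d1]] comp[OF d2] by (rule taylor_linear_bigo)
    have taylor': "(\<lambda>w. \<phi>' w $ i - \<phi>' 0 $ i) \<in> O[at 0](\<lambda>w. w)" for i
      using comp[OF d2] by (rule real_differentiable_at_0_bigo)
    \<comment> \<open>The kernel is spanned by (1, 0, \<open>Ra\<close>); its vanishing second entry
      is what makes \<open>y - Ra\<close> of order 2.\<close>
    have ker': "\<phi>' 0 $ 2 = 0" "\<phi>' 0 $ 3 = Ra * \<phi>' 0 $ 1"
      using ker unfolding \<phi>'_def[symmetric] system_jacobian_mult
      by (auto simp: vec_eq_iff forall_3)
    have "\<phi>' 0 $ 1 \<noteq> 0"
      using nz ker' unfolding \<phi>'_def[symmetric] by (auto simp: vec_eq_iff forall_3)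
    \<comment> \<open>Since \<open>K * Ra = \<sigma>\<close>, the left kernel vector (1, 0,
      \<open>K\<close>) pairs with the tangent to a nonzero number, so \<open>g\<close> can be
      recovered from the velocity of \<open>x + K * z\<close>.\<close>
    moreover have "\<phi>' 0 $ 1 + K * \<phi>' 0 $ 3 = (1 + \<sigma>) * \<phi>' 0 $ 1"
      unfolding ker' K_def crit[symmetric] by (simp add: algebra_simps)
    ultimately have l: "\<phi>' 0 $ 1 + K * \<phi>' 0 $ 3 \<noteq> 0" using \<open>\<sigma> > 0\<close> by simp
    have "(\<lambda>w. (\<phi>' w $ 1 - \<phi>' 0 $ 1) + K * (\<phi>' w $ 3 - \<phi>' 0 $ 3)) \<in> O[at 0](\<lambda>w. w)"
      using taylor'[of 3] by (intro sum_in_bigo(1)[OF taylor']) simp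
    then have l': "(\<lambda>w. (\<phi>' w $ 1 + K * \<phi>' w $ 3) - (\<phi>' 0 $ 1 + K * \<phi>' 0 $ 3))
        \<in> O[at 0](\<lambda>w. w)"
      by (simp add: algebra_simps)
    have eqs: "g w * \<phi>' w $ 1 = A * \<phi> w $ 2 * \<phi> w $ 3 + C * \<phi> w $ 3 - \<sigma> * \<phi> w $ 1"
      "g w * \<phi>' w $ 2 = - \<phi> w $ 1 * \<phi> w $ 3 - (\<phi> w $ 2 - Ra)"
      "g w * \<phi>' w $ 3 = - \<phi> w $ 3 + \<phi> w $ 1 * \<phi> w $ 2"
      if "w \<in> {-\<delta><..<\<delta>}" for w
      using inv[OF that] unfolding \<phi>'_def[symmetric] system_field_def Let_def
      by (simp_all add: vec_eq_iff forall_3)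
    have at0: "eventually (\<lambda>w. w \<in> {-\<delta><..<\<delta>}) (at 0)"
      using nhd by (simp add: eventually_nhds_conv_at)
    \<comment> \<open>After writing the second coordinate as \<open>Ra\<close> plus a deviation, the
      linear terms cancel by \<open>K = A * Ra + C\<close> and
      \<open>K * Ra = \<sigma>\<close>.\<close>
    have gl: "g w * (\<phi>' w $ 1 + K * \<phi>' w $ 3) =
        (\<phi> w $ 2 - Ra) * (A * \<phi> w $ 3 + K * \<phi> w $ 1)" if "w \<in> {-\<delta><..<\<delta>}" for w
    proof -
      have "g w * (\<phi>' w $ 1 + K * \<phi>' w $ 3) = g w * \<phi>' w $ 1 + K * (g w * \<phi>' w $ 3)"
        by (simp add: algebra_simps)
      also have "\<dots> = (\<phi> w $ 2 - Ra) * (A * \<phi> w $ 3 + K * \<phi> w $ 1)"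
        unfolding eqs[OF that] K_def crit[symmetric] by (simp add: algebra_simps)
      finally show ?thesis .
    qed
    \<comment> \<open>For the tangent (a, 0, \<open>Ra\<close> a) the cubic coefficient equals
      \<open>- a^2 * Ra * (A * Ra + K) / (1 + \<sigma>)\<close>, which is strictly negative.\<close>
    have "cubic_expansion g 0 (- (\<phi>' 0 $ 1 * \<phi>' 0 $ 3) *
        (A * \<phi>' 0 $ 3 + K * \<phi>' 0 $ 1) / (\<phi>' 0 $ 1 + K * \<phi>' 0 $ 3))"
    proof (rule reduced_cubic_expansion[where y = "\<lambda>w. \<phi> w $ 2 - Ra", OF _ _ _ _ l' l])
      show "(\<lambda>w. \<phi> w $ 1 - \<phi>' 0 $ 1 * w) \<in> O[at 0](\<lambda>w. w^2)"
        using taylor[of 1] by (simp add: \<phi>0)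
      show "(\<lambda>w. \<phi> w $ 3 - \<phi>' 0 $ 3 * w) \<in> O[at 0](\<lambda>w. w^2)"
        using taylor[of 3] by (simp add: \<phi>0)
      show "(\<lambda>w. \<phi> w $ 2 - Ra) \<in> O[at 0](\<lambda>w. w^2)"
        using taylor[of 2] by (simp add: \<phi>0 ker')
      show "(\<lambda>w. \<phi>' w $ 2) \<in> O[at 0](\<lambda>w. w)"
        using taylor'[of 2] by (simp add: ker')
      show "\<forall>\<^sub>F w in at 0. g w * (\<phi>' w $ 1 + K * \<phi>' w $ 3) =
          (\<phi> w $ 2 - Ra) * (A * \<phi> w $ 3 + K * \<phi> w $ 1)"
        using at0 gl by (rule eventually_mono)
      show "\<forall>\<^sub>F w in at 0. g w * \<phi>' w $ 2 = - \<phi> w $ 1 * \<phi> w $ 3 - (\<phi> w $ 2 - Ra)"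
        using at0 eqs(2) by (rule eventually_mono)
    qed
    then show ?thesis by blast
  qed
  moreover have "?F ?E = 0"
    by (simp add: system_field_def vec_eq_iff forall_3)
  moreover have "?F differentiable (at ?E)"
    using system_field_has_derivative by (rule differentiableI)
  ultimately show ?thesis
    unfolding cusp_bifurcation_def simple_eigenvalue_def jacobian_system_field by blast
qed

end
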